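(* Let $n$ and $a$ be positive integers and let $b=\gcd(n,a)$. Then $$ \sum_{d\mid n}\mu(d)\frac{(q^{ad};q^{ad})_{n/d}}{(q^d;q^d)_{n/d}}\equiv 0\pmod{[n]_{q^b}} $$ in the polynomial ring $\mathbb{Z}[q]$, i.e. the polynomial on the left is divisible by $[n]_{q^b}$ in $\mathbb{Z}[q]$.
   Context: $\mu$ denotes the Möbius function, and the sum runs over the positive divisors $d$ of $n$. For a nonnegative integer $m$, $[m]_x=\frac{1-x^m}{1-x}=1+x+\cdots+x^{m-1}$, so $[n]_{q^b}=1+q^b+q^{2b}+\cdots+q^{(n-1)b}$. For $m\ge 1$, $(x;q)_m=(1-x)(1-xq)\cdots(1-xq^{m-1})$, and $(x;q)_0=1$. Thus $\frac{(q^{ad};q^{ad})_{n/d}}{(q^d;q^d)_{n/d}}=\prod_{j=1}^{n/d}\frac{1-q^{jad}}{1-q^{jd}}=\prod_{j=1}^{n/d}[a]_{q^{jd}}$, which is a polynomial in $q$ with integer coefficients. *)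

theory Defs
  imports "HOL-Computational_Algebra.Computational_Algebra"
begin

definition moebius_mu :: "nat \<Rightarrow> int" where
  "moebius_mu n = (if squarefree n then (-1) ^ card (prime_factors n) else 0)"

definition q_bracket :: "nat \<Rightarrow> 'a :: comm_ring_1 \<Rightarrow> 'a" where
  "q_bracket m x = (\<Sum>k<m. x ^ k)"

definition q_pochhammer :: "'a :: comm_ring_1 \<Rightarrow> 'a \<Rightarrow> nat \<Rightarrow> 'a" where
  "q_pochhammer x q m = (\<Prod>k<m. 1 - x * q ^ k)"

lemma q_bracket_mult: "(1 - x) * q_bracket m x = 1 - x ^ m"
  by (simp add: q_bracket_def one_diff_power_eq)

lemma q_pochhammer_factor:
  "q_pochhammer (x ^ a) (x ^ a) m = q_pochhammer x x m * (\<Prod>j=1..m. q_bracket a (x ^ j))"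
proof -
  have "q_pochhammer (x ^ a) (x ^ a) m = (\<Prod>k<m. (1 - x ^ Suc k) * q_bracket a (x ^ Suc k))"
    unfolding q_pochhammer_def
  proof (rule prod.cong)
    fix k
    show "1 - x ^ a * (x ^ a) ^ k = (1 - x ^ Suc k) * q_bracket a (x ^ Suc k)"
      unfolding q_bracket_mult
      by (simp flip: power_mult power_add add: algebra_simps)
  qed simp
  also have "\<dots> = q_pochhammer x x m * (\<Prod>k<m. q_bracket a (x ^ Suc k))"
    by (simp add: q_pochhammer_def prod.distrib)
  also have "(\<Prod>k<m. q_bracket a (x ^ Suc k)) = (\<Prod>j=1..m. q_bracket a (x ^ j))"
    by (rule prod.reindex_bij_witness[of _ "\<lambda>j. j - 1" Suc]) auto
  finally show ?thesis .
qed

text \<open>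
  The operation \<^term>\<open>(div)\<close> on integer polynomials is meaningful only when the division is exact.
  The quotients of interest are exact:
\<close>

lemma q_pochhammer_div:
  assumes "d > 0"
  shows "q_pochhammer (monom 1 (a * d)) (monom 1 (a * d)) m
           div q_pochhammer (monom 1 d) (monom 1 d) m
         = (\<Prod>j=1..m. q_bracket a (monom (1::int) (j * d)))"
proof -
  have pw: "monom (1::int) (k * d) = monom 1 d ^ k" for k
    by (simp add: monom_power mult.commute)
  have "1 - monom (1::int) d * monom 1 d ^ k \<noteq> 0" for k
  proof
    assume "1 - monom (1::int) d * monom 1 d ^ k = 0"
    hence "coeff (1 - monom (1::int) (d + d * k)) 0 = 0"
      by (simp add: monom_power mult_monom)
    thus False using assms by simp
  qed
  hence "q_pochhammer (monom (1::int) d) (monom 1 d) m \<noteq> 0"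
    by (simp add: q_pochhammer_def)
  thus ?thesis by (simp only: pw q_pochhammer_factor) simp
qed

end

theory Submission
  imports Defs "HOL-Number_Theory.Cong"
begin

text \<open>
  Let \<open>S\<close> be the sum. Since \<open>(1 - q^b) [n]_{q^b} = 1 - q^(nb)\<close> has simple complex roots, it suffices
  that \<open>S\<close> vanishes at every \<open>z\<close> with \<open>z^(nb) = 1\<close> and \<open>z^b \<noteq> 1\<close>. If \<open>z^n \<noteq> 1\<close>, then each summand
  contains the factor \<open>[a]_{z^n}\<close>, which is zero because \<open>z^(na) = 1\<close>. If \<open>z^n = 1\<close>, then \<open>z^a \<noteq> 1\<close>, so
  the order \<open>m\<close> of \<open>z\<close> divides \<open>n\<close> but not \<open>a\<close>, and some prime \<open>p\<close> divides \<open>m\<close> to a higher power than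
  \<open>a\<close>. With \<open>r\<close> the order of \<open>z^d\<close>, the product indexed by \<open>d\<close> equals \<open>a^(n/(dr))\<close> or \<open>0\<close> according to
  whether \<open>r\<close> is coprime to \<open>a\<close>; the choice of \<open>p\<close> makes it take the same value at \<open>d\<close> and \<open>pd\<close> whenever
  \<open>p\<close> does not divide \<open>d\<close>, and these terms cancel because \<open>\<mu>(pd) = -\<mu>(d)\<close>.
\<close>

subsection \<open>Evaluating integer polynomials at complex numbers\<close>

definition int_poly_eval :: "complex \<Rightarrow> int poly \<Rightarrow> complex" where
  "int_poly_eval z p = poly (map_poly of_int p) z"

lemma int_poly_eval_0 [simp]: "int_poly_eval z 0 = 0"
  and int_poly_eval_1 [simp]: "int_poly_eval z 1 = 1"
  by (simp_all add: int_poly_eval_def)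

lemma int_poly_eval_monom [simp]: "int_poly_eval z (monom c k) = of_int c * z ^ k"
  by (simp add: int_poly_eval_def map_poly_monom poly_monom)

lemma int_poly_eval_add [simp]: "int_poly_eval z (p + q) = int_poly_eval z p + int_poly_eval z q"
proof -
  have "map_poly of_int (p + q) = map_poly of_int p + (map_poly of_int q :: complex poly)"
    by (rule poly_eqI) (simp add: coeff_map_poly)
  thus ?thesis by (simp add: int_poly_eval_def)
qed

lemma int_poly_eval_diff [simp]: "int_poly_eval z (p - q) = int_poly_eval z p - int_poly_eval z q"
  using int_poly_eval_add[of z "p - q" q] by simp

lemma int_poly_eval_mult [simp]: "int_poly_eval z (p * q) = int_poly_eval z p * int_poly_eval z q"
proof -
  have "map_poly of_int (p * q) = map_poly of_int p * (map_poly of_int q :: complex poly)"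
    by (rule poly_eqI) (simp add: coeff_map_poly coeff_mult)
  thus ?thesis by (simp add: int_poly_eval_def)
qed

lemma int_poly_eval_smult [simp]: "int_poly_eval z (smult c p) = of_int c * int_poly_eval z p"
  using int_poly_eval_mult[of z "monom c 0" p] int_poly_eval_monom[of z c 0] by (simp add: monom_0)

lemma int_poly_eval_power [simp]: "int_poly_eval z (p ^ k) = int_poly_eval z p ^ k"
  by (induction k) simp_all

lemma int_poly_eval_sum: "int_poly_eval z (\<Sum>i\<in>A. f i) = (\<Sum>i\<in>A. int_poly_eval z (f i))"
  by (induction A rule: infinite_finite_induct) simp_all

lemma int_poly_eval_prod: "int_poly_eval z (\<Prod>i\<in>A. f i) = (\<Prod>i\<in>A. int_poly_eval z (f i))"
  by (induction A rule: infinite_finite_induct) simp_all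

lemma int_poly_eval_q_bracket:
  "int_poly_eval z (q_bracket a p) = q_bracket a (int_poly_eval z p)"
  by (simp add: q_bracket_def int_poly_eval_sum)

text \<open>The divisor is monic, so division with remainder works over the integers. A nonzero
  remainder would have degree below \<open>N\<close> yet vanish at all \<open>N\<close> complex
  \<open>N\<close>-th roots of unity.\<close>

lemma monom_minus_one_dvdI:
  fixes T :: "int poly"
  assumes N: "N > 0" and roots: "\<And>z. z ^ N = 1 \<Longrightarrow> int_poly_eval z T = 0"
  shows "monom 1 N - 1 dvd T"
proof -
  define g :: "int poly" where "g = monom 1 N - 1"
  have deg: "degree g = N"
  proof (rule antisym)
    show "degree g \<le> N"
      unfolding g_def using degree_diff_le[of "monom 1 N" N "1 :: int poly"]
      by (simp add: degree_monom_eq)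
    show "N \<le> degree g" using N by (intro le_degree) (simp add: g_def)
  qed
  have g: "lead_coeff g = 1" using N by (simp add: deg) (simp add: g_def)
  hence "g \<noteq> 0" by auto
  obtain q r where qr: "pseudo_divmod T g = (q, r)" by fastforce
  \<comment> \<open>Pseudo-division scales \<open>T\<close> by a power of the leading coefficient of
    \<open>g\<close>, which is 1.\<close>
  have T: "T = g * q + r" using pseudo_divmod(1)[OF \<open>g \<noteq> 0\<close> qr] g by simp
  have r: "r = 0 \<or> degree r < N" using pseudo_divmod(2)[OF \<open>g \<noteq> 0\<close> qr] deg by simp
  have "r = 0"
  proof (rule ccontr)
    assume "r \<noteq> 0"
    let ?r = "map_poly of_int r :: complex poly"
    have "?r \<noteq> 0" using \<open>r \<noteq> 0\<close> by (simp add: map_poly_eq_0_iff)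
    have "int_poly_eval z r = 0" if "z ^ N = 1" for z
      using roots[OF that] that by (simp add: T g_def)
    hence "{z. z ^ N = 1} \<subseteq> {z. poly ?r z = 0}" by (auto simp: int_poly_eval_def)
    hence "card {z::complex. z ^ N = 1} \<le> card {z. poly ?r z = 0}"
      by (intro card_mono poly_roots_finite \<open>?r \<noteq> 0\<close>)
    also have "\<dots> \<le> degree ?r" by (rule card_poly_roots_bound[OF \<open>?r \<noteq> 0\<close>])
    also have "\<dots> \<le> degree r" by (rule map_poly_degree_leq)
    finally show False using r \<open>r \<noteq> 0\<close> card_roots_unity_eq[OF N] by simp
  qed
  thus ?thesis using T by (simp add: g_def)
qed

subsection \<open>Roots of unity\<close>

lemma root_of_unity_order:
  fixes z :: "'a :: idom"
  assumes "z ^ n = 1" "n > 0"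
  obtains m where "m > 0" "\<And>k. z ^ k = 1 \<longleftrightarrow> m dvd k"
proof -
  define m where "m = (LEAST m. m > 0 \<and> z ^ m = 1)"
  have m: "m > 0" "z ^ m = 1"
    using LeastI[of "\<lambda>m. m > 0 \<and> z ^ m = 1" n] assms by (auto simp: m_def)
  have "z ^ k = 1 \<longleftrightarrow> m dvd k" for k
  proof
    assume "z ^ k = 1"
    have "z ^ k = (z ^ m) ^ (k div m) * z ^ (k mod m)"
      by (simp flip: power_mult power_add)
    hence "z ^ (k mod m) = 1" using m \<open>z ^ k = 1\<close> by simp
    moreover have "k mod m < m" using m by simp
    ultimately have "k mod m = 0"
      using not_less_Least[of "k mod m" "\<lambda>m. m > 0 \<and> z ^ m = 1"] by (auto simp: m_def)
    thus "m dvd k" by auto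
  next
    assume "m dvd k"
    thus "z ^ k = 1" using m by (auto simp: power_mult)
  qed
  thus ?thesis using m that by blast
qed

lemma q_bracket_eq_0:
  fixes x :: "'a :: idom"
  assumes "x ^ a = 1" "x \<noteq> 1"
  shows "q_bracket a x = 0"
  using q_bracket_mult[of x a] assms by simp

text \<open>For \<open>r\<close> coprime to \<open>a\<close>, multiplication by \<open>a\<close>
  permutes the nonzero residues mod \<open>r\<close>; as [a]_x = (1 - x^a)/(1 - x), the factors with
  \<open>j < r\<close> cancel to 1, and \<open>j = r\<close> contributes [a]_1 = a. Otherwise the
  factor at \<open>j = r div gcd r a\<close> vanishes.\<close>

lemma prod_q_bracket_full_period:
  fixes w :: "'a :: idom"
  assumes ord: "\<And>k. w ^ k = 1 \<longleftrightarrow> r dvd k" and r: "r > 0"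
  shows "(\<Prod>j=1..r. q_bracket a (w ^ j)) = (if coprime r a then of_nat a else 0)"
proof (cases "coprime r a")
  case True
  let ?h = "\<lambda>j. j * a mod r"
  have ne: "w ^ j \<noteq> 1" if "j \<in> {1..<r}" for j
    using that by (auto simp: ord dest: dvd_imp_le)
  have inj: "inj_on ?h {1..<r}"
  proof (rule inj_onI)
    fix i j assume ij: "i \<in> {1..<r}" "j \<in> {1..<r}" "i * a mod r = j * a mod r"
    have "[i * a = j * a] (mod r)" using ij by (simp add: unique_euclidean_semiring_class.cong_def)
    hence "[i = j] (mod r)" using True by (simp add: cong_mult_rcancel_nat coprime_commute)
    thus "i = j" using ij by (simp add: unique_euclidean_semiring_class.cong_def)
  qed
  have sub: "?h ` {1..<r} \<subseteq> {1..<r}"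
  proof safe
    fix j assume j: "j \<in> {1..<r}"
    hence "\<not> r dvd j" by (auto dest: dvd_imp_le)
    hence "\<not> r dvd j * a" using True by (simp add: coprime_dvd_mult_left_iff)
    thus "?h j \<in> {1..<r}" using r by (auto simp: dvd_eq_mod_eq_0 Suc_le_eq)
  qed
  have bij: "bij_betw ?h {1..<r} {1..<r}"
    using inj sub endo_inj_surj[of "{1..<r}" ?h] by (simp add: bij_betw_def)
  have pow_mod: "w ^ (k mod r) = w ^ k" for k
  proof -
    have "w ^ k = (w ^ r) ^ (k div r) * w ^ (k mod r)" by (simp flip: power_mult power_add)
    thus ?thesis using ord[of r] by simp
  qed
  have "(\<Prod>j\<in>{1..<r}. 1 - w ^ j) * (\<Prod>j\<in>{1..<r}. q_bracket a (w ^ j))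
      = (\<Prod>j\<in>{1..<r}. 1 - w ^ ?h j)"
    by (simp add: q_bracket_mult pow_mod power_mult flip: prod.distrib)
  also have "\<dots> = (\<Prod>j\<in>{1..<r}. 1 - w ^ j)"
    by (rule prod.reindex_bij_betw[OF bij])
  finally have "(\<Prod>j\<in>{1..<r}. q_bracket a (w ^ j)) = 1"
    using ne by (auto simp: prod_zero_iff)
  moreover have "{1..r} = insert r {1..<r}" using r by auto
  moreover have "q_bracket a (w ^ r) = of_nat a" using ord[of r] by (simp add: q_bracket_def)
  ultimately show ?thesis using True by simp
next
  case False
  define g where "g = gcd r a"
  have "g \<noteq> 1" using False by (simp add: g_def coprime_iff_gcd_eq_1)
  moreover have "g > 0" using r by (simp add: g_def)
  ultimately have "g > 1" by linarith
  obtain s where s: "r = g * s" by (metis g_def gcd_dvd1 dvdE)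
  obtain t where t: "a = g * t" by (metis g_def gcd_dvd2 dvdE)
  have "s > 0" "s < r" using r s \<open>g > 1\<close> by auto
  have "w ^ s \<noteq> 1" using \<open>s > 0\<close> \<open>s < r\<close> by (auto simp: ord dest: dvd_imp_le)
  moreover have "(w ^ s) ^ a = 1"
    by (simp add: ord s t flip: power_mult)
  ultimately have "q_bracket a (w ^ s) = 0" by (rule q_bracket_eq_0[rotated])
  thus ?thesis using False \<open>s > 0\<close> \<open>s < r\<close> by (auto intro!: prod_zero bexI[of _ s])
qed

text \<open>The factors depend on \<open>j\<close> only modulo \<open>r\<close>, so the range splits
  into \<open>k\<close> equal full periods.\<close>

lemma prod_q_bracket_periods:
  fixes w :: "'a :: idom"
  assumes ord: "\<And>k. w ^ k = 1 \<longleftrightarrow> r dvd k" and r: "r > 0"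
  shows "(\<Prod>j=1..r * k. q_bracket a (w ^ j)) = (if coprime r a then of_nat a else 0) ^ k"
proof (induction k)
  case (Suc k)
  have "(\<Prod>j=1..r * k + r. q_bracket a (w ^ j))
      = (\<Prod>j=1..r * k. q_bracket a (w ^ j)) * (\<Prod>j=r * k + 1..r * k + r. q_bracket a (w ^ j))"
    by (rule prod.ub_add_nat) simp
  also have "(\<Prod>j=r * k + 1..r * k + r. q_bracket a (w ^ j))
      = (\<Prod>j=1..r. q_bracket a (w ^ (j + r * k)))"
    using prod.shift_bounds_cl_nat_ivl[of "\<lambda>j. q_bracket a (w ^ j)" 1 "r * k" r]
    by (simp add: add.commute)
  also have "\<dots> = (\<Prod>j=1..r. q_bracket a (w ^ j))"
    using ord[of "r * k"] by (simp add: power_add)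
  finally show ?case
    using Suc prod_q_bracket_full_period[OF assms] by (simp add: add.commute)
qed simp

subsection \<open>Cancellation in Moebius sums\<close>

lemma moebius_mu_prime_mult:
  assumes "prime p" "\<not> p dvd d"
  shows "moebius_mu (p * d) = - moebius_mu d"
proof (cases "squarefree d")
  case True
  have "d \<noteq> 0" using assms by (cases "d = 0") auto
  have "coprime p d" using assms by (simp add: prime_imp_coprime)
  hence "squarefree (p * d)"
    using True squarefree_prime[OF assms(1)] by (intro squarefree_mult_coprime)
  moreover have "prime_factors (p * d) = insert p (prime_factors d)"
    using assms \<open>d \<noteq> 0\<close> by (subst prime_factors_product) (auto simp: prime_factorization_prime)
  moreover have "p \<notin> prime_factors d" using assms by auto
  ultimately show ?thesis using True by (simp add: moebius_mu_def)
next
  case False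
  hence "\<not> squarefree (p * d)" using squarefree_mono[of d "p * d"] by auto
  thus ?thesis using False by (simp add: moebius_mu_def)
qed

text \<open>Divisors not divisible by \<open>p\<close> pair with their \<open>p\<close>-fold:
  \<open>moebius_mu\<close> changes sign while \<open>f\<close> keeps its value. The divisors left
  over are multiples of \<open>p ^ 2\<close>, where \<open>moebius_mu\<close> is zero.\<close>

lemma moebius_sum_eq_0:
  fixes f :: "nat \<Rightarrow> 'a :: comm_ring_1"
  assumes n: "n > 0" and p: "prime p" "p dvd n"
    and f: "\<And>d. p * d dvd n \<Longrightarrow> \<not> p dvd d \<Longrightarrow> f (p * d) = f d"
  shows "(\<Sum>d | d dvd n. of_int (moebius_mu d) * f d) = 0"
proof -
  let ?g = "\<lambda>d. of_int (moebius_mu d) * f d"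
  let ?A = "{d. d dvd n \<and> \<not> p dvd d}"
  have pA: "p * d dvd n" if "d \<in> ?A" for d
    using that p by (intro divides_mult) (auto simp: prime_imp_coprime)
  have inj: "inj_on ((*) p) ?A" using p by (auto simp: inj_on_def)
  have fin: "finite ?A" "finite {d. d dvd n}" using n by simp_all
  have "(\<Sum>d | d dvd n. ?g d) = (\<Sum>d\<in>?A \<union> (*) p ` ?A. ?g d)"
  proof (rule sum.mono_neutral_right)
    show "finite {d. d dvd n}" by fact
    show "?A \<union> (*) p ` ?A \<subseteq> {d. d dvd n}" using pA by auto
    show "\<forall>d\<in>{d. d dvd n} - (?A \<union> (*) p ` ?A). ?g d = 0"
    proof
      fix d assume d: "d \<in> {d. d dvd n} - (?A \<union> (*) p ` ?A)"
      then obtain e where e: "d = p * e" by (auto elim: dvdE)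
      have "e dvd n" using d e dvd_trans[of e d n] by simp
      \<comment> \<open>Otherwise \<open>e\<close> would lie in \<open>?A\<close>, and
        \<open>d\<close> in its image.\<close>
      hence "p dvd e" using d e by blast
      hence "p ^ 2 dvd d" using e by (simp add: power2_eq_square)
      hence "\<not> squarefree d" using p(1) by (intro not_squarefreeI) auto
      thus "?g d = 0" by (simp add: moebius_mu_def)
    qed
  qed
  also have "\<dots> = sum ?g ?A + sum ?g ((*) p ` ?A)"
    using fin by (intro sum.union_disjoint) auto
  also have "sum ?g ((*) p ` ?A) = (\<Sum>d\<in>?A. ?g (p * d))"
    using inj by (simp add: sum.reindex)
  also have "\<dots> = (\<Sum>d\<in>?A. - ?g d)"
    using p(1) f pA by (intro sum.cong) (auto simp: moebius_mu_prime_mult)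
  finally show ?thesis by (simp add: sum_negf)
qed

lemma q_bracket_moebius_sum_eq_0:
  fixes z :: "'a :: idom"
  assumes n: "n > 0" and a: "a > 0" and z: "z ^ n = 1" "z ^ a \<noteq> 1"
  shows "(\<Sum>d | d dvd n. of_int (moebius_mu d) * (\<Prod>j=1..n div d. q_bracket a (z ^ (j * d)))) = 0"
proof -
  obtain m where m: "m > 0" and ord: "\<And>k. z ^ k = 1 \<longleftrightarrow> m dvd k"
    using root_of_unity_order[OF z(1) n] by blast
  have "m dvd n" "\<not> m dvd a" using z ord by auto
  then obtain p where p: "prime p" and mult: "multiplicity p a < multiplicity p m"
    using multiplicity_le_imp_dvd[of m a] m by (metis linorder_not_le not_gr_zero)
  have "p dvd m" using mult by (metis not_dvd_imp_multiplicity_0 not_less_zero)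
  \<comment> \<open>For \<open>p\<close> dividing \<open>a\<close>, losing one factor
    \<open>p\<close> from the order must leave another.\<close>
  have sq: "p ^ 2 dvd m" if "p dvd a"
  proof -
    have "multiplicity p a > 0" using that p a by (simp add: prime_multiplicity_gt_zero_iff)
    thus ?thesis using mult by (intro multiplicity_dvd') simp
  qed
  show ?thesis
  proof (rule moebius_sum_eq_0[OF n p])
    show "p dvd n" using \<open>p dvd m\<close> \<open>m dvd n\<close> by (rule dvd_trans)
  next
    fix d assume d: "p * d dvd n" "\<not> p dvd d"
    have "d > 0" using d by (cases "d = 0") auto
    \<comment> \<open>This is the order of \<open>z ^ d\<close>. As \<open>p\<close> does not divide
      \<open>d\<close>, \<open>gcd m d\<close> is prime to \<open>p\<close>, so \<open>r\<close>
      keeps the full power of \<open>p\<close> in \<open>m\<close>.\<close>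
    define r where "r = m div gcd m d"
    have m_eq: "m = gcd m d * r" by (simp add: r_def)
    have cop: "coprime (p ^ k) (gcd m d)" for k
      using p d(2) by (metis coprime_power_left_iff dvd_trans gcd_dvd2 prime_imp_coprime)
    have "p dvd r"
      using \<open>p dvd m\<close> m_eq cop[of 1] by (metis coprime_dvd_mult_right_iff power_one_right)
    \<comment> \<open>\<open>s\<close> turns out to be the order of
      \<open>z ^ (p * d)\<close>.\<close>
    then obtain s where s: "r = p * s" by blast
    have "r > 0" "s > 0" using m m_eq s by (metis mult_is_0 not_gr_zero)+
    have ord_r: "(z ^ d) ^ k = 1 \<longleftrightarrow> r dvd k" for k
    proof -
      define e where "e = d div gcd m d"
      have "coprime r e" using m unfolding r_def e_def by (intro div_gcd_coprime) simp
      have "d = gcd m d * e" by (simp add: e_def)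
      hence "m dvd d * k \<longleftrightarrow> gcd m d * r dvd gcd m d * (e * k)"
        using m_eq by (metis mult.assoc)
      also have "\<dots> \<longleftrightarrow> r dvd k"
        using m \<open>coprime r e\<close> by (simp add: coprime_dvd_mult_right_iff)
      finally have "m dvd d * k \<longleftrightarrow> r dvd k" .
      thus ?thesis by (simp add: ord flip: power_mult)
    qed
    have ord_s: "(z ^ (p * d)) ^ k = 1 \<longleftrightarrow> s dvd k" for k
    proof -
      have "(z ^ (p * d)) ^ k = (z ^ d) ^ (p * k)" by (simp add: mult_ac flip: power_mult)
      thus ?thesis using ord_r[of "p * k"] p by (auto simp: s)
    qed
    \<comment> \<open>If \<open>p\<close> divides \<open>a\<close>, then \<open>p\<close> still
      divides \<open>s\<close> and both sides fail; otherwise the extra factor \<open>p\<close> of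
      \<open>r\<close> shares nothing with \<open>a\<close>.\<close>
    have "coprime r a \<longleftrightarrow> coprime s a"
    proof (cases "p dvd a")
      case True
      have "p ^ 2 dvd r"
        using sq[OF True] m_eq cop[of 2] by (metis coprime_dvd_mult_right_iff)
      hence "p dvd s" using p by (auto simp: s power2_eq_square)
      thus ?thesis using True p s
        by (metis coprime_common_divisor dvd_triv_left not_prime_unit)
    next
      case False
      thus ?thesis using p by (simp add: s prime_imp_coprime)
    qed
    have "(z ^ d) ^ (n div d) = 1"
      using z d by (auto simp flip: power_mult dest: dvd_mult_right)
    then obtain k where k: "n div d = r * k" using ord_r by auto
    \<comment> \<open>Both products consist of the same number \<open>k\<close> of full periods, of
      lengths \<open>r\<close> and \<open>s\<close>, so their values agree.\<close>
    have "n div (p * d) = s * k"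
      using k p by (simp add: s mult.commute[of p d] div_mult2_eq mult.assoc)
    thus "(\<Prod>j=1..n div (p * d). q_bracket a (z ^ (j * (p * d))))
        = (\<Prod>j=1..n div d. q_bracket a (z ^ (j * d)))"
      using prod_q_bracket_periods[OF ord_r \<open>r > 0\<close>, of a k]
        prod_q_bracket_periods[OF ord_s \<open>s > 0\<close>, of a k] k \<open>coprime r a \<longleftrightarrow> coprime s a\<close>
      by (simp add: mult.commute flip: power_mult)
  qed
qed

theorem mainTheorem1:
  fixes n a b :: nat
  assumes "n > 0" and "a > 0" and "b = gcd n a"
  shows "q_bracket n (monom (1::int) b) dvd
    (\<Sum>d | d dvd n. smult (moebius_mu d)
       (q_pochhammer (monom 1 (a * d)) (monom 1 (a * d)) (n div d)
          div q_pochhammer (monom 1 d) (monom 1 d) (n div d)))"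
proof -
  let ?x = "monom (1::int) b"
  \<comment> \<open>The quotients are replaced by the products they equal, since evaluation commutes
    with products but not in general with \<open>div\<close>.\<close>
  define S :: "int poly" where "S = (\<Sum>d | d dvd n. smult (moebius_mu d)
       (\<Prod>j=1..n div d. q_bracket a (monom 1 (j * d))))"
  have S: "(\<Sum>d | d dvd n. smult (moebius_mu d)
       (q_pochhammer (monom 1 (a * d)) (monom 1 (a * d)) (n div d)
          div q_pochhammer (monom 1 d) (monom 1 d) (n div d))) = S"
    unfolding S_def using assms(1)
    by (intro sum.cong refl arg_cong2[of _ _ _ _ smult] q_pochhammer_div)
      (auto intro!: Nat.gr0I)
  have "b > 0" using assms by simp
  have eval_S: "int_poly_eval z S = (\<Sum>d | d dvd n. of_int (moebius_mu d) *
      (\<Prod>j=1..n div d. q_bracket a (z ^ (j * d))))" for z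
    by (simp add: S_def int_poly_eval_sum int_poly_eval_prod int_poly_eval_q_bracket)
  have zero: "int_poly_eval z S = 0" if z: "z ^ (n * b) = 1" "z ^ b \<noteq> 1" for z
  proof (cases "z ^ n = 1")
    case True
    obtain m where ord: "\<And>k. z ^ k = 1 \<longleftrightarrow> m dvd k"
      using root_of_unity_order[OF True assms(1)] by blast
    \<comment> \<open>Otherwise the order \<open>m\<close> would divide both \<open>n\<close> and
      \<open>a\<close>, hence \<open>b\<close>.\<close>
    have "z ^ a \<noteq> 1" using True z(2) ord assms(3) by simp
    thus ?thesis using q_bracket_moebius_sum_eq_0[OF assms(1,2) True] eval_S by simp
  next
    case False
    obtain t where "a = b * t" using assms(3) by (metis gcd_dvd2 dvdE)
    hence "(z ^ n) ^ a = (z ^ (n * b)) ^ t" by (simp add: mult.assoc flip: power_mult)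
    hence "q_bracket a (z ^ n) = 0" using False z(1) by (intro q_bracket_eq_0) simp_all
    \<comment> \<open>The vanishing factor is the last one, \<open>j = n div d\<close>, where
      \<open>z ^ (j * d) = z ^ n\<close>.\<close>
    hence "(\<Prod>j=1..n div d. q_bracket a (z ^ (j * d))) = 0" if "d dvd n" for d
      using that assms(1)
      by (intro prod_zero bexI[of _ "n div d"]) (auto simp: Suc_le_eq div_greater_zero_iff dest: dvd_imp_le)
    thus ?thesis unfolding eval_S by (intro sum.neutral) (simp del: prod_zero_iff)
  qed
  \<comment> \<open>The factor \<open>?x - 1\<close> supplies the zeros with
    \<open>z ^ b = 1\<close>, so every root of unity of order dividing \<open>n * b\<close> is
    covered; cancelling it afterwards leaves \<open>q_bracket n ?x\<close>.\<close>
  have "monom 1 (n * b) - 1 dvd (?x - 1) * S"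
  proof (rule monom_minus_one_dvdI)
    show "n * b > 0" using assms(1) \<open>b > 0\<close> by simp
    show "int_poly_eval z ((?x - 1) * S) = 0" if "z ^ (n * b) = 1" for z
      using zero[OF that] by auto
  qed
  moreover have "monom 1 (n * b) - 1 = (?x - 1) * q_bracket n ?x"
    using q_bracket_mult[of ?x n] by (simp add: monom_power algebra_simps)
  moreover have "?x - 1 \<noteq> 0"
  proof
    assume "?x - 1 = 0"
    hence "coeff (?x - 1) b = 0" by simp
    thus False using \<open>b > 0\<close> by simp
  qed
  ultimately show ?thesis unfolding S by simp
qed

end
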